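(* Let $p(z)$ be a prior density and let $p(y\mid z)$ be a likelihood, with $p(z,\mathcal{D}) = p(z)\prod_{y\in\mathcal{D}}p(y\mid z)$ for every dataset $\mathcal{D}$. Let $\mathcal{D}$ and $\mathcal{D}^*$ be datasets, let $K\ge 1$, let $z_1,\dots,z_K$ be i.i.d. samples from the exact posterior $p(z\mid\mathcal{D})$, and let $$R_K=\frac1K\sum_{k=1}^K p(\mathcal{D}^*\mid z_k).$$ Then $$\mathrm{SNR}(R_K)=\frac{\sqrt K}{\sqrt{\exp(\delta)^2-1}},$$ where $\delta$ is given by either of the following two equal expressions: $$\delta=\tfrac12\,\mathrm{KL}\big(p(z\mid\mathcal{D}+\mathcal{D}^* )\,\|\,p(z\mid\mathcal{D})\big)+\tfrac12\,\mathrm{KL}\big(p(z\mid\mathcal{D}+\mathcal{D}^* )\,\|\,p(z\mid\mathcal{D}+2\mathcal{D}^* )\big)$$ $$\phantom{\delta}=\frac{V(\mathcal{D})+V(\mathcal{D}+2\mathcal{D}^* )}{2}-V(\mathcal{D}+\mathcal{D}^* ),$$ where $V(\mathcal{D})=\log\int p(\mathcal{D}\mid z)p(z)\,dz$.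
   Context: Datasets are finite multisets: $\mathcal{D}+\mathcal{D}^*$ denotes multiset addition and $2\mathcal{D}^*=\mathcal{D}^*+\mathcal{D}^*$. The likelihood of a dataset is $p(\mathcal{D}\mid z)=\prod_{y\in\mathcal{D}}p(y\mid z)$ (with multiplicity), so $p(\mathcal{D}+\mathcal{D}^*\mid z)=p(\mathcal{D}\mid z)p(\mathcal{D}^*\mid z)$. The posterior is $p(z\mid\mathcal{D})=p(\mathcal{D}\mid z)p(z)/\exp V(\mathcal{D})$. The posteriors appearing in the claim are assumed well defined, i.e. $\int p(\cdot\mid z)p(z)\,dz\in(0,\infty)$ for the datasets $\mathcal{D}$, $\mathcal{D}+\mathcal{D}^*$, $\mathcal{D}+2\mathcal{D}^*$. For a nonnegative random variable $R$, $\mathrm{SNR}(R)=\mathbb{E}[R]/\sqrt{\mathbb{V}[R]}$, where $\mathbb V$ is the variance; it is read as $+\infty$ when $\mathbb{V}[R]=0$ (equivalently $\delta=0$). $\mathrm{KL}(a\|b)=\int a(z)\log\frac{a(z)}{b(z)}\,dz$. *)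

theory Defs
  imports "HOL-Probability.Probability"
begin

definition prob_density :: "'a measure \<Rightarrow> ('a \<Rightarrow> real) \<Rightarrow> bool" where
  "prob_density M f \<longleftrightarrow>
     f \<in> borel_measurable M \<and> (\<forall>x\<in>space M. 0 \<le> f x) \<and> (\<integral>\<^sup>+x. ennreal (f x) \<partial>M) = 1"

text \<open>
  Densities of the latent variable are taken with respect to a reference measure \<open>M\<close> and densities
  of an observation with respect to a reference measure \<open>N\<close> (Lebesgue, counting, \<open>\<dots>\<close>).
  \<open>lik y z\<close> stands for $p(y \mid z)$.
\<close>

definition likelihood :: "'z measure \<Rightarrow> 'y measure \<Rightarrow> ('y \<Rightarrow> 'z \<Rightarrow> real) \<Rightarrow> bool" where
  "likelihood M N lik \<longleftrightarrow>
     (\<forall>y\<in>space N. lik y \<in> borel_measurable M) \<and>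
     (\<forall>z\<in>space M. prob_density N (\<lambda>y. lik y z))"

definition data_lik :: "('y \<Rightarrow> 'z \<Rightarrow> real) \<Rightarrow> 'y multiset \<Rightarrow> 'z \<Rightarrow> real" where
  "data_lik lik D z = (\<Prod>y\<in>#D. lik y z)"

definition evidence ::
  "'z measure \<Rightarrow> ('z \<Rightarrow> real) \<Rightarrow> ('y \<Rightarrow> 'z \<Rightarrow> real) \<Rightarrow> 'y multiset \<Rightarrow> real" where
  "evidence M prior lik D = (\<integral>z. data_lik lik D z * prior z \<partial>M)"

text \<open>Integrability is required explicitly because \<open>evidence\<close> is \<open>0\<close> for a divergent integral.\<close>

definition posterior_exists ::
  "'z measure \<Rightarrow> ('z \<Rightarrow> real) \<Rightarrow> ('y \<Rightarrow> 'z \<Rightarrow> real) \<Rightarrow> 'y multiset \<Rightarrow> bool" where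
  "posterior_exists M prior lik D \<longleftrightarrow>
     integrable M (\<lambda>z. data_lik lik D z * prior z) \<and> 0 < evidence M prior lik D"

definition log_evidence ::
  "'z measure \<Rightarrow> ('z \<Rightarrow> real) \<Rightarrow> ('y \<Rightarrow> 'z \<Rightarrow> real) \<Rightarrow> 'y multiset \<Rightarrow> real" where
  "log_evidence M prior lik D = ln (evidence M prior lik D)"

definition posterior ::
  "'z measure \<Rightarrow> ('z \<Rightarrow> real) \<Rightarrow> ('y \<Rightarrow> 'z \<Rightarrow> real) \<Rightarrow> 'y multiset \<Rightarrow> 'z \<Rightarrow> real" where
  "posterior M prior lik D z = data_lik lik D z * prior z / exp (log_evidence M prior lik D)"

text \<open>
  The divergence of probability densities \<open>a\<close> and \<open>b\<close>, with its usual value \<open>\<infinity>\<close> when \<open>a\<close> is not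
  absolutely continuous with respect to \<open>b\<close>. The negative part of the integrand is always integrable
  for probability densities, so a failure of integrability also means that the value is \<open>\<infinity>\<close>.
  The convention \<open>0 \<cdot> log 0 = 0\<close> is built into the arithmetic. The constant \<open>KL_divergence\<close> of
  the library is real-valued and does not distinguish these infinite cases.
\<close>

definition KL :: "'a measure \<Rightarrow> ('a \<Rightarrow> real) \<Rightarrow> ('a \<Rightarrow> real) \<Rightarrow> ereal" where
  "KL M a b =
     (if (AE z in M. b z = 0 \<longrightarrow> a z = 0) \<and> integrable M (\<lambda>z. a z * ln (a z / b z))
      then ereal (\<integral>z. a z * ln (a z / b z) \<partial>M) else \<infinity>)"

text \<open>Intended for square-integrable \<open>R\<close>; otherwise the library's \<open>variance\<close> is not meaningful.\<close>

definition SNR :: "'w measure \<Rightarrow> ('w \<Rightarrow> real) \<Rightarrow> ereal" where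
  "SNR \<Omega> R =
     (if prob_space.variance \<Omega> R = 0 then \<infinity>
      else ereal (prob_space.expectation \<Omega> R / sqrt (prob_space.variance \<Omega> R)))"

end

theory Submission
  imports Defs
begin

text \<open>
  Write \<open>f = p(\<D> | z) p(z)\<close>, \<open>g = p(\<D>\<^sup>* | z)\<close> and let \<open>Z\<^sub>i\<close> be the integral of \<open>f g\<^sup>i\<close> for \<open>i = 0, 1, 2\<close>.
  Under the posterior of \<open>\<D>\<close> the variable \<open>g\<close> has mean \<open>Z\<^sub>1/Z\<^sub>0\<close> and second moment \<open>Z\<^sub>2/Z\<^sub>0\<close>, and
  averaging \<open>K\<close> independent copies divides the variance by \<open>K\<close>; moreover \<open>exp(\<delta>)\<^sup>2 = Z\<^sub>0 Z\<^sub>2/Z\<^sub>1\<^sup>2\<close>.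
  Both divergences are finite, because \<open>\<bar>g ln g\<bar> \<le> 1 + g\<^sup>2\<close>. With \<open>L\<close> the integral of \<open>f g ln g\<close>
  they equal \<open>L/Z\<^sub>1 + ln Z\<^sub>0 - ln Z\<^sub>1\<close> and \<open>-L/Z\<^sub>1 + ln Z\<^sub>2 - ln Z\<^sub>1\<close>, so \<open>L\<close> cancels in their mean.
\<close>

text \<open>Both bounds come from \<open>ln t \<le> t - 1\<close>, at \<open>t = x\<close> for the
  upper and \<open>t = 1 / x\<close> for the lower one. Multiplied by \<open>f\<close>, the estimate
  dominates the entropy-like integrand \<open>f g ln g\<close> by two integrable functions.\<close>

lemma abs_mult_ln_le:
  fixes x :: real
  assumes "0 \<le> x"
  shows "\<bar>x * ln x\<bar> \<le> 1 + x\<^sup>2"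
proof (cases "x = 0")
  case False
  with assms have x: "0 < x" by simp
  have "x * ln x \<le> x * (x - 1)"
    using x ln_le_minus_one[OF x] by (intro mult_left_mono) auto
  then have upper: "x * ln x \<le> 1 + x\<^sup>2"
    using x by (simp add: power2_eq_square algebra_simps)
  have "x * (- ln x) \<le> x * (1 / x - 1)"
    using x ln_le_minus_one[of "1 / x"] by (intro mult_left_mono) (auto simp: ln_div)
  also have "\<dots> = 1 - x"
    using x by (simp add: field_simps)
  also have "\<dots> \<le> 1 + x\<^sup>2"
    using x by (smt (verit) zero_le_power2)
  finally show ?thesis using upper by simp
qed simp

section \<open>Moments of averages of independent variables\<close>

text \<open>Independence of a new term from the partial sum factors the mixed moment. Square
  integrability is part of the induction, since \<open>variance_eq\<close> needs it for the partial
  sum.\<close>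

lemma (in prob_space) variance_sum_indep:
  fixes X :: "'i \<Rightarrow> 'a \<Rightarrow> real"
  assumes "finite I" and "indep_vars (\<lambda>_. borel) X I"
    and "\<And>i. i \<in> I \<Longrightarrow> integrable M (X i)"
    and "\<And>i. i \<in> I \<Longrightarrow> integrable M (\<lambda>\<omega>. (X i \<omega>)\<^sup>2)"
  shows "integrable M (\<lambda>\<omega>. (\<Sum>i\<in>I. X i \<omega>)\<^sup>2) \<and>
    variance (\<lambda>\<omega>. \<Sum>i\<in>I. X i \<omega>) = (\<Sum>i\<in>I. variance (X i))"
  using assms
proof (induction I rule: finite_induct)
  case empty
  then show ?case by simp
next
  case (insert j I)
  define S where "S = (\<lambda>\<omega>. \<Sum>i\<in>I. X i \<omega>)"
  have j: "integrable M (X j)" "integrable M (\<lambda>\<omega>. (X j \<omega>)\<^sup>2)"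
    using insert.prems by auto
  have "indep_vars (\<lambda>_. borel) X I"
    using insert.prems(1) by (rule indep_vars_subset) auto
  then have S2: "integrable M (\<lambda>\<omega>. (S \<omega>)\<^sup>2)"
    and var: "variance S = (\<Sum>i\<in>I. variance (X i))"
    using insert.IH insert.prems unfolding S_def by auto
  have S: "integrable M S"
    unfolding S_def using insert.prems by (intro Bochner_Integration.integrable_sum) auto
  have ind: "indep_var borel (X j) borel S"
    unfolding S_def using insert.hyps insert.prems(1) by (rule indep_vars_sum)
  have prod: "integrable M (\<lambda>\<omega>. X j \<omega> * S \<omega>)"
    and prod_eq: "expectation (\<lambda>\<omega>. X j \<omega> * S \<omega>) = expectation (X j) * expectation S"
    using indep_var_integrable[OF ind j(1) S] indep_var_lebesgue_integral[OF ind j(1) S] by auto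
  have sq: "(X j \<omega> + S \<omega>)\<^sup>2 = (X j \<omega>)\<^sup>2 + (S \<omega>)\<^sup>2 + 2 * (X j \<omega> * S \<omega>)" for \<omega>
    by (simp add: power2_sum)
  have sum2: "integrable M (\<lambda>\<omega>. (X j \<omega> + S \<omega>)\<^sup>2)"
    unfolding sq using j S2 prod by simp
  have "variance (\<lambda>\<omega>. X j \<omega> + S \<omega>)
      = expectation (\<lambda>\<omega>. (X j \<omega> + S \<omega>)\<^sup>2) - (expectation (\<lambda>\<omega>. X j \<omega> + S \<omega>))\<^sup>2"
    using j S sum2 by (intro variance_eq) auto
  \<comment> \<open>What remains of the mixed terms is twice the covariance of \<open>X j\<close>
    and \<open>S\<close>, which is 0 by \<open>prod_eq\<close>.\<close>
  also have "\<dots> = variance (X j) + variance S"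
    unfolding sq variance_eq[OF j] variance_eq[OF S S2]
    using j S S2 prod by (simp add: prod_eq power2_sum)
  finally show ?case
    using insert.hyps sum2 var by (simp add: S_def)
qed

lemma (in prob_space) expectation_variance_sample_mean:
  fixes X :: "nat \<Rightarrow> 'a \<Rightarrow> real"
  assumes K: "1 \<le> K"
    and indep: "indep_vars (\<lambda>_. borel) X {1..K}"
    and int: "\<And>k. k \<in> {1..K} \<Longrightarrow> integrable M (X k)"
    and int2: "\<And>k. k \<in> {1..K} \<Longrightarrow> integrable M (\<lambda>\<omega>. (X k \<omega>)\<^sup>2)"
    and mean: "\<And>k. k \<in> {1..K} \<Longrightarrow> expectation (X k) = \<mu>"
    and moment2: "\<And>k. k \<in> {1..K} \<Longrightarrow> expectation (\<lambda>\<omega>. (X k \<omega>)\<^sup>2) = m"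
  shows "expectation (\<lambda>\<omega>. 1 / real K * (\<Sum>k=1..K. X k \<omega>)) = \<mu>"
    and "variance (\<lambda>\<omega>. 1 / real K * (\<Sum>k=1..K. X k \<omega>)) = (m - \<mu>\<^sup>2) / real K"
proof -
  let ?S = "\<lambda>\<omega>. \<Sum>k=1..K. X k \<omega>"
  have ES: "expectation ?S = real K * \<mu>"
    using int mean by (subst Bochner_Integration.integral_sum) auto
  then show E: "expectation (\<lambda>\<omega>. 1 / real K * ?S \<omega>) = \<mu>"
    using K by simp
  have "variance ?S = (\<Sum>k=1..K. variance (X k))"
    using variance_sum_indep[OF _ indep int int2] by simp
  also have "\<dots> = (\<Sum>k=1..K. m - \<mu>\<^sup>2)"
  proof (rule sum.cong)
    fix k assume k: "k \<in> {1..K}"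
    show "variance (X k) = m - \<mu>\<^sup>2"
      using variance_eq[OF int[OF k] int2[OF k]] mean[OF k] moment2[OF k] by simp
  qed simp
  finally have VS: "variance ?S = real K * (m - \<mu>\<^sup>2)"
    by simp
  \<comment> \<open>Centring the mean at \<open>\<mu>\<close> is centring the sum at
    \<open>real K * \<mu>\<close>, so the factor \<open>1 / real K\<close> comes out
    squared.\<close>
  have "(1 / real K * ?S \<omega> - \<mu>)\<^sup>2 = (1 / real K)\<^sup>2 * (?S \<omega> - real K * \<mu>)\<^sup>2" for \<omega>
    using K by (simp add: power_mult_distrib[symmetric] right_diff_distrib)
  then have "variance (\<lambda>\<omega>. 1 / real K * ?S \<omega>) = (1 / real K)\<^sup>2 * variance ?S"
    unfolding E ES by simp
  then show "variance (\<lambda>\<omega>. 1 / real K * ?S \<omega>) = (m - \<mu>\<^sup>2) / real K"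
    unfolding VS using K by (simp add: power2_eq_square)
qed

section \<open>Divergences between tilted densities\<close>

text \<open>An integrable closed form \<open>h\<close> of the integrand, together with absolute
  continuity, selects the finite branch of \<open>KL\<close>.\<close>

lemma KL_eqI:
  assumes "\<And>z. z \<in> space M \<Longrightarrow> b z = 0 \<Longrightarrow> a z = 0"
    and eq: "\<And>z. z \<in> space M \<Longrightarrow> a z * ln (a z / b z) = h z"
    and "integrable M h"
  shows "KL M a b = ereal (\<integral>z. h z \<partial>M)"
proof -
  have "integrable M (\<lambda>z. a z * ln (a z / b z))"
    using assms(3) by (simp add: eq cong: Bochner_Integration.integrable_cong)
  moreover have "(\<integral>z. a z * ln (a z / b z) \<partial>M) = (\<integral>z. h z \<partial>M)"
    using eq by (rule Bochner_Integration.integral_cong[OF refl])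
  moreover have "AE z in M. b z = 0 \<longrightarrow> a z = 0"
    using assms(1) by (intro AE_I2) auto
  ultimately show ?thesis
    unfolding KL_def by simp
qed

text \<open>The density proportional to \<open>f g\<close> is compared with its neighbours
  proportional to \<open>f\<close> and \<open>f g^2\<close>. The log ratios are \<open>ln g\<close>
  and \<open>- ln g\<close> up to constants, hence the cancellation.\<close>

lemma mean_KL_tilted:
  fixes f g :: "'a \<Rightarrow> real"
  assumes [measurable]: "g \<in> borel_measurable M"
    and nonneg: "\<And>z. z \<in> space M \<Longrightarrow> 0 \<le> f z" "\<And>z. z \<in> space M \<Longrightarrow> 0 \<le> g z"
    and int: "integrable M f" "integrable M (\<lambda>z. f z * g z)" "integrable M (\<lambda>z. f z * (g z)\<^sup>2)"
    and Z0: "Z0 = (\<integral>z. f z \<partial>M)" "0 < Z0"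
    and Z1: "Z1 = (\<integral>z. f z * g z \<partial>M)" "0 < Z1"
    and Z2: "Z2 = (\<integral>z. f z * (g z)\<^sup>2 \<partial>M)" "0 < Z2"
  shows "ereal (1 / 2) * KL M (\<lambda>z. f z * g z / Z1) (\<lambda>z. f z / Z0)
      + ereal (1 / 2) * KL M (\<lambda>z. f z * g z / Z1) (\<lambda>z. f z * (g z)\<^sup>2 / Z2)
    = ereal ((ln Z0 + ln Z2) / 2 - ln Z1)"
proof -
  have [measurable]: "f \<in> borel_measurable M"
    using int(1) by simp
  define L where "L = (\<integral>z. f z * (g z * ln (g z)) \<partial>M)"
  have intL: "integrable M (\<lambda>z. f z * (g z * ln (g z)))"
  proof (rule Bochner_Integration.integrable_bound)
    show "integrable M (\<lambda>z. f z + f z * (g z)\<^sup>2)"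
      using int by simp
    show "AE z in M. norm (f z * (g z * ln (g z))) \<le> norm (f z + f z * (g z)\<^sup>2)"
    proof (rule AE_I2)
      fix z assume z: "z \<in> space M"
      have "f z * \<bar>g z * ln (g z)\<bar> \<le> f z * (1 + (g z)\<^sup>2)"
        using nonneg[OF z] abs_mult_ln_le by (intro mult_left_mono) auto
      then show "norm (f z * (g z * ln (g z))) \<le> norm (f z + f z * (g z)\<^sup>2)"
        using nonneg[OF z] by (simp add: abs_mult algebra_simps)
    qed
  qed simp
  \<comment> \<open>One template serves both divergences: \<open>s\<close> is the sign of
    \<open>ln g\<close> in the log ratio and \<open>c\<close> the difference of log normalisers. The
    latter integrates to \<open>c\<close> because \<open>Z1\<close> is the integral of
    \<open>f g\<close>.\<close>
  define h where "h s c z = (s * (f z * (g z * ln (g z))) + c * (f z * g z)) / Z1" for s c z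
  have int_h: "integrable M (h s c)" and integral_h: "(\<integral>z. h s c z \<partial>M) = s * L / Z1 + c" for s c
    using int intL Z1 by (simp_all add: h_def[abs_def] L_def add_divide_distrib)
  have "KL M (\<lambda>z. f z * g z / Z1) (\<lambda>z. f z / Z0) = ereal (\<integral>z. h 1 (ln Z0 - ln Z1) z \<partial>M)"
  proof (rule KL_eqI[OF _ _ int_h])
    fix z assume z: "z \<in> space M"
    show "f z * g z / Z1 * ln (f z * g z / Z1 / (f z / Z0)) = h 1 (ln Z0 - ln Z1) z"
    \<comment> \<open>Where \<open>f\<close> or \<open>g\<close> vanishes, the factor
      \<open>f z * g z\<close> makes both sides 0 whatever value \<open>ln\<close> takes; elsewhere
      the logarithm splits.\<close>
    proof (cases "f z = 0 \<or> g z = 0")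
      case False
      with nonneg[OF z] have "0 < f z" "0 < g z" by auto
      then have ln_eq: "ln (f z * g z / Z1 / (f z / Z0)) = ln (g z) + ln Z0 - ln Z1"
        using Z0 Z1 by (simp add: ln_div ln_mult)
      show ?thesis unfolding ln_eq h_def by (simp add: algebra_simps diff_divide_distrib add_divide_distrib)
    qed (auto simp: h_def)
  qed (use Z0(2) in auto)
  moreover have "KL M (\<lambda>z. f z * g z / Z1) (\<lambda>z. f z * (g z)\<^sup>2 / Z2)
      = ereal (\<integral>z. h (-1) (ln Z2 - ln Z1) z \<partial>M)"
  proof (rule KL_eqI[OF _ _ int_h])
    fix z assume z: "z \<in> space M"
    show "f z * g z / Z1 * ln (f z * g z / Z1 / (f z * (g z)\<^sup>2 / Z2)) = h (-1) (ln Z2 - ln Z1) z"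
    proof (cases "f z = 0 \<or> g z = 0")
      case False
      with nonneg[OF z] have "0 < f z" "0 < g z" by auto
      then have ln_eq: "ln (f z * g z / Z1 / (f z * (g z)\<^sup>2 / Z2)) = - ln (g z) + ln Z2 - ln Z1"
        using Z1 Z2 by (simp add: ln_div ln_mult ln_realpow)
      show ?thesis unfolding ln_eq h_def by (simp add: algebra_simps diff_divide_distrib add_divide_distrib)
    qed (auto simp: h_def)
  \<comment> \<open>Absolute continuity: \<open>f z * (g z)\<^sup>2 = 0\<close> forces
    \<open>f z * g z = 0\<close>.\<close>
  qed (use Z2(2) in auto)
  ultimately show ?thesis
    unfolding integral_h by (simp add: field_simps)
qed

section \<open>Likelihoods of datasets\<close>

lemma data_lik_union: "data_lik lik (A + B) z = data_lik lik A z * data_lik lik B z"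
  by (simp add: data_lik_def)

lemma data_lik_nonneg:
  assumes "likelihood M N lik" "set_mset A \<subseteq> space N" "z \<in> space M"
  shows "0 \<le> data_lik lik A z"
  using assms(2)
proof (induction A)
  case (add y A)
  then have "0 \<le> lik y z"
    using assms(1,3) by (auto simp: likelihood_def prob_density_def)
  with add show ?case by (simp add: data_lik_def)
qed (simp add: data_lik_def)

lemma borel_measurable_data_lik:
  assumes "likelihood M N lik" "set_mset A \<subseteq> space N"
  shows "data_lik lik A \<in> borel_measurable M"
  using assms(2)
proof (induction A)
  case empty
  then show ?case by (simp add: data_lik_def[abs_def])
next
  case (add y A)
  then have "lik y \<in> borel_measurable M"
    using assms(1) by (auto simp: likelihood_def)
  moreover have "data_lik lik A \<in> borel_measurable M"
    using add by auto
  ultimately show ?case by (simp add: data_lik_def[abs_def])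
qed

section \<open>From moments to the signal-to-noise ratio\<close>

text \<open>The degenerate case is covered: for \<open>(exp \<delta>)\<^sup>2 = 1\<close> the
  variance is 0, and a positive number divided by 0 is infinite in \<open>ereal\<close>, as in
  \<open>SNR\<close>.\<close>

lemma SNR_tilted:
  assumes "0 < K" "0 < (Z0::real)" "0 < Z1" "0 < Z2"
    and \<delta>: "\<delta> = (ln Z0 + ln Z2) / 2 - ln Z1"
    and E: "prob_space.expectation \<Omega> R = Z1 / Z0"
    and V: "prob_space.variance \<Omega> R = (Z2 / Z0 - (Z1 / Z0)\<^sup>2) / real K"
  shows "SNR \<Omega> R = ereal (sqrt (real K)) / ereal (sqrt ((exp \<delta>)\<^sup>2 - 1))"
proof -
  have "(exp \<delta>)\<^sup>2 = exp (ln Z0 + ln Z2 - 2 * ln Z1)"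
    unfolding \<delta> by (simp add: exp_double[symmetric] algebra_simps)
  also have "\<dots> = Z0 * Z2 / Z1\<^sup>2"
    using assms(2-4) by (simp add: exp_diff exp_add exp_double)
  \<comment> \<open>With the squared mean factored out, \<open>Z1 / Z0\<close> cancels in the ratio
    of mean to standard deviation.\<close>
  finally have "Z2 / Z0 - (Z1 / Z0)\<^sup>2 = (Z1 / Z0)\<^sup>2 * ((exp \<delta>)\<^sup>2 - 1)"
    using assms(2-4) by (simp add: field_simps power2_eq_square)
  then have V': "prob_space.variance \<Omega> R = (Z1 / Z0)\<^sup>2 * ((exp \<delta>)\<^sup>2 - 1) / real K"
    using V by simp
  have "sqrt ((Z1 / Z0)\<^sup>2 * ((exp \<delta>)\<^sup>2 - 1) / real K)
      = Z1 / Z0 * sqrt ((exp \<delta>)\<^sup>2 - 1) / sqrt (real K)"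
    using assms(2,3) by (simp add: real_sqrt_mult real_sqrt_divide)
  then show ?thesis
    unfolding SNR_def E V'[unfolded E] using assms(1-3) by simp
qed

text \<open>Here \<open>\<delta>\<close> is fixed as a real by the evidences; its equality with the
  \<open>ereal\<close> mean of the divergences therefore includes their finiteness.\<close>

theorem theorem1:
  fixes M :: "'z measure" and N :: "'y measure" and \<Omega> :: "'w measure"
    and prior :: "'z \<Rightarrow> real" and lik :: "'y \<Rightarrow> 'z \<Rightarrow> real"
    and D Ds :: "'y multiset" and K :: nat and Z :: "nat \<Rightarrow> 'w \<Rightarrow> 'z" and \<delta> :: real
  assumes prior: "prob_density M prior"
    and lik: "likelihood M N lik"
    and data: "set_mset D \<subseteq> space N" "set_mset Ds \<subseteq> space N"
    and posteriors: "posterior_exists M prior lik D"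
      "posterior_exists M prior lik (D + Ds)"
      "posterior_exists M prior lik (D + (Ds + Ds))"
    and K: "1 \<le> K"
    and \<Omega>: "prob_space \<Omega>"
    and indep: "prob_space.indep_vars \<Omega> (\<lambda>_. M) Z {1..K}"
    and samples: "\<And>k. k \<in> {1..K} \<Longrightarrow>
      distributed \<Omega> M (Z k) (\<lambda>z. ennreal (posterior M prior lik D z))"
    and delta: "\<delta> = (log_evidence M prior lik D + log_evidence M prior lik (D + (Ds + Ds))) / 2
      - log_evidence M prior lik (D + Ds)"
  shows "SNR \<Omega> (\<lambda>\<omega>. 1 / real K * (\<Sum>k=1..K. data_lik lik Ds (Z k \<omega>)))
        = ereal (sqrt (real K)) / ereal (sqrt ((exp \<delta>)\<^sup>2 - 1))
    \<and> ereal \<delta>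
        = ereal (1 / 2) * KL M (posterior M prior lik (D + Ds)) (posterior M prior lik D)
          + ereal (1 / 2) * KL M (posterior M prior lik (D + Ds))
              (posterior M prior lik (D + (Ds + Ds)))"
proof -
  interpret \<Omega>: prob_space \<Omega> by (rule \<Omega>)
  define f where "f z = data_lik lik D z * prior z" for z
  define g where "g = data_lik lik Ds"
  define Z0 where "Z0 = (\<integral>z. f z \<partial>M)"
  define Z1 where "Z1 = (\<integral>z. f z * g z \<partial>M)"
  define Z2 where "Z2 = (\<integral>z. f z * (g z)\<^sup>2 \<partial>M)"
  have g_measurable[measurable]: "g \<in> borel_measurable M"
    unfolding g_def using lik data(2) by (rule borel_measurable_data_lik)
  have nonneg: "0 \<le> f z" "0 \<le> g z" if "z \<in> space M" for z
    using data_lik_nonneg[OF lik data(1) that] data_lik_nonneg[OF lik data(2) that] prior that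
    by (auto simp: f_def g_def prob_density_def)
  have eq0: "data_lik lik D z * prior z = f z"
    and eq1: "data_lik lik (D + Ds) z * prior z = f z * g z"
    and eq2: "data_lik lik (D + (Ds + Ds)) z * prior z = f z * (g z)\<^sup>2" for z
    by (simp_all add: f_def g_def data_lik_union power2_eq_square algebra_simps)
  have ev: "evidence M prior lik D = Z0" "evidence M prior lik (D + Ds) = Z1"
    "evidence M prior lik (D + (Ds + Ds)) = Z2"
    unfolding evidence_def eq0 eq1 eq2 Z0_def Z1_def Z2_def by simp_all
  have int: "integrable M f" "integrable M (\<lambda>z. f z * g z)" "integrable M (\<lambda>z. f z * (g z)\<^sup>2)"
    and pos: "0 < Z0" "0 < Z1" "0 < Z2"
    using posteriors unfolding posterior_exists_def ev eq0 eq1 eq2 by auto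
  have post: "posterior M prior lik D = (\<lambda>z. f z / Z0)"
    "posterior M prior lik (D + Ds) = (\<lambda>z. f z * g z / Z1)"
    "posterior M prior lik (D + (Ds + Ds)) = (\<lambda>z. f z * (g z)\<^sup>2 / Z2)"
    using pos unfolding posterior_def[abs_def] log_evidence_def ev eq0 eq1 eq2 by simp_all
  have \<delta>: "\<delta> = (ln Z0 + ln Z2) / 2 - ln Z1"
    unfolding delta log_evidence_def ev ..
  \<comment> \<open>Expectations over \<open>\<Omega>\<close> become integrals against the density
    \<open>f / Z0\<close> of a sample; this is applied to \<open>g\<close> and its square.\<close>
  have moments: "integrable \<Omega> (\<lambda>\<omega>. h (Z k \<omega>)) \<and>
      \<Omega>.expectation (\<lambda>\<omega>. h (Z k \<omega>)) = (\<integral>z. f z * h z \<partial>M) / Z0"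
    if k: "k \<in> {1..K}" and h: "h \<in> borel_measurable M" "integrable M (\<lambda>z. f z * h z)"
    for k and h :: "'z \<Rightarrow> real"
  proof -
    have dist: "distributed \<Omega> M (Z k) (\<lambda>z. ennreal (f z / Z0))"
      using samples[OF k] unfolding post .
    have f0: "\<And>z. z \<in> space M \<Longrightarrow> 0 \<le> f z / Z0"
      using nonneg pos by simp
    have "integrable M (\<lambda>z. f z / Z0 * h z)"
      using h(2) by simp
    then show ?thesis
      using distributed_integrable[OF dist h(1) f0] distributed_integral[OF dist h(1) f0] by simp
  qed
  have indep_g: "\<Omega>.indep_vars (\<lambda>_. borel) (\<lambda>k \<omega>. g (Z k \<omega>)) {1..K}"
    using indep by (rule \<Omega>.indep_vars_compose2) simp
  \<comment> \<open>Existence of the posterior for \<open>D + (Ds + Ds)\<close> is what makes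
    \<open>g\<close> square integrable under the posterior of \<open>D\<close>, so the variance is
    meaningful.\<close>
  have mean: "integrable \<Omega> (\<lambda>\<omega>. g (Z k \<omega>))" "\<Omega>.expectation (\<lambda>\<omega>. g (Z k \<omega>)) = Z1 / Z0"
    and square: "integrable \<Omega> (\<lambda>\<omega>. (g (Z k \<omega>))\<^sup>2)"
      "\<Omega>.expectation (\<lambda>\<omega>. (g (Z k \<omega>))\<^sup>2) = Z2 / Z0"
    if "k \<in> {1..K}" for k
    using moments[OF that, of g] moments[OF that, of "\<lambda>z. (g z)\<^sup>2"] int
    by (auto simp: Z1_def Z2_def)
  have "SNR \<Omega> (\<lambda>\<omega>. 1 / real K * (\<Sum>k=1..K. g (Z k \<omega>)))
      = ereal (sqrt (real K)) / ereal (sqrt ((exp \<delta>)\<^sup>2 - 1))"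
    using K \<Omega>.expectation_variance_sample_mean[OF K indep_g mean(1) square(1) mean(2) square(2)]
    by (intro SNR_tilted[OF _ pos \<delta>]) simp_all
  moreover have "ereal \<delta>
      = ereal (1 / 2) * KL M (\<lambda>z. f z * g z / Z1) (\<lambda>z. f z / Z0)
        + ereal (1 / 2) * KL M (\<lambda>z. f z * g z / Z1) (\<lambda>z. f z * (g z)\<^sup>2 / Z2)"
    unfolding \<delta> using mean_KL_tilted[OF g_measurable nonneg int Z0_def pos(1) Z1_def pos(2) Z2_def pos(3)]
    by simp
  ultimately show ?thesis
    unfolding post g_def by blast
qed

end
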